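(* Let $T$ be a rooted tree of size $s$ with descent set $V_D$. Then for every integer $n\ge s$, $$ d(T;n+1)=d(T;n)+\sum_{v\in V'}d(T/v;n)+\sum_{v\in V''}\ \sum_{r=1}^{2^{c(v)}}d\big((T/v)_r;n\big). $$
   Context: Rooted trees are finite and nonempty. $T$ has vertex set $V$ of size $s$; $p(v)$ is the parent of a non-root vertex $v$. $T$ comes with a distinguished subset $V_D\subseteq V$, whose elements are called descent vertices; all other vertices are ascent vertices. For an integer $n\ge s$, $G(T;n)$ is the rooted tree with $n$ vertices obtained by adding a chain of $n-s$ vertices above the root of $T$ (if $n>s$, the root of $T$ becomes the child of the bottom vertex of the chain and the top of the chain is the root of $G(T;n)$); the added vertices are ascent vertices. A labeling of a rooted tree with $m$ vertices is a bijection $w$ from its vertices to $[m]=\{1,\dots,m\}$, and $\mathrm{Des}(w)$ is the set of non-root vertices $v$ with $w(v)>w(p(v))$. $D(T;n)$ is the set of labelings $w$ of $G(T;n)$ with $\mathrm{Des}(w)=V_D$, and $d(T;n)=|D(T;n)|$. By convention $d(\emptyset;k)=1$ for the empty tree and $k\ge0$. Define $V'=\{v\in V_D: v\text{ is a leaf}\}$ and $V''=\{v\in V_D: v\text{ is not a leaf and no child of }v\text{ is in }V_D\}$. A leaf is a vertex with no children. $T/v$ is the tree obtained from $T$ by deleting $v$ and contracting the edge between $v$ and its parent, so that the children of $v$ become children of the parent of $v$; vertices of $T/v$ that are not original children of $v$ inherit from $T$ the property of being or not being descent vertices. In particular, if $v$ is a leaf, $T/v$ is $T$ with the vertex $v$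 removed (the empty tree if $v$ is the only vertex). If $v$ has $c(v)$ children, then there are $2^{c(v)}$ ways to specify which of these (now children of the former parent of $v$) are descent vertices; the resulting trees with distinguished descent sets are denoted $(T/v)_r$, $1\le r\le 2^{c(v)}$. If $v\in V''$ is the root of $T$, its parent is the bottom vertex of the chain added above $T$: in that case $T/v$ is understood to be the tree whose root is that (ascent) chain vertex, with the children of $v$ (and the subtrees below them) attached to it. *)

theory Defs
  imports Main "HOL-Library.FuncSet"
begin

text \<open>A tree is given by its vertex set, the parent map (the value \<open>None\<close> marks the root) and the
  set of descent vertices. Values of the parent map outside the vertex set are irrelevant.\<close>

record 'a dtree =
  verts :: "'a set"
  parent :: "'a \<Rightarrow> 'a option"
  desc :: "'a set"

definition is_root :: "'a dtree \<Rightarrow> 'a \<Rightarrow> bool" where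
  "is_root T r \<longleftrightarrow> r \<in> verts T \<and> parent T r = None"

definition rooted_tree :: "'a dtree \<Rightarrow> bool" where
  "rooted_tree T \<longleftrightarrow>
     finite (verts T) \<and> desc T \<subseteq> verts T \<and>
     (\<forall>v \<in> verts T. \<forall>u. parent T v = Some u \<longrightarrow> u \<in> verts T) \<and>
     (\<exists>r. is_root T r \<and>
        (\<forall>v \<in> verts T. (v, r) \<in> {(x, y). x \<in> verts T \<and> parent T x = Some y}\<^sup>*))"

definition children :: "'a dtree \<Rightarrow> 'a \<Rightarrow> 'a set" where
  "children T v = {u \<in> verts T. parent T u = Some v}"

definition is_leaf :: "'a dtree \<Rightarrow> 'a \<Rightarrow> bool" where
  "is_leaf T v \<longleftrightarrow> v \<in> verts T \<and> children T v = {}"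

text \<open>\<open>G T n\<close> adds the chain \<open>Inr 0, Inr 1, \<dots>, Inr (n - s - 1)\<close>, listed from bottom to top, above
  the root of \<open>T\<close>, where \<open>s\<close> is the size of \<open>T\<close>. It is meant for \<open>n \<ge> s\<close>; \<open>G T s\<close> is a copy of \<open>T\<close>.\<close>

definition G :: "'a dtree \<Rightarrow> nat \<Rightarrow> ('a + nat) dtree" where
  "G T n = \<lparr>
     verts = Inl ` verts T \<union> Inr ` {..<n - card (verts T)},
     parent = (\<lambda>x. case x of
         Inl v \<Rightarrow> (case parent T v of
             Some u \<Rightarrow> Some (Inl u)
           | None \<Rightarrow> if 0 < n - card (verts T) then Some (Inr 0) else None)
       | Inr i \<Rightarrow> if Suc i < n - card (verts T) then Some (Inr (Suc i)) else None),
     desc = Inl ` desc T \<rparr>"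

text \<open>Labelings are taken to be \<open>undefined\<close> outside the vertex set, so that they are counted as
  functions on the vertex set only.\<close>

definition labelings :: "'a dtree \<Rightarrow> ('a \<Rightarrow> nat) set" where
  "labelings T =
     {w \<in> extensional (verts T). bij_betw w (verts T) {1..card (verts T)}}"

definition Des :: "'a dtree \<Rightarrow> ('a \<Rightarrow> nat) \<Rightarrow> 'a set" where
  "Des T w = {v \<in> verts T. \<exists>u. parent T v = Some u \<and> w v > w u}"

definition D :: "'a dtree \<Rightarrow> nat \<Rightarrow> ('a + nat \<Rightarrow> nat) set" where
  "D T n = {w \<in> labelings (G T n). Des (G T n) w = Inl ` desc T}"

definition d :: "'a dtree \<Rightarrow> nat \<Rightarrow> nat" where
  "d T n = (if verts T = {} then 1 else card (D T n))"

definition V' :: "'a dtree \<Rightarrow> 'a set" where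
  "V' T = {v \<in> desc T. is_leaf T v}"

definition V'' :: "'a dtree \<Rightarrow> 'a set" where
  "V'' T = {v \<in> desc T. \<not> is_leaf T v \<and> children T v \<inter> desc T = {}}"

text \<open>Deletes \<open>v\<close> and attaches its children to the parent of \<open>v\<close>; \<open>R\<close> is the set of those
  former children of \<open>v\<close> that are declared to be descent vertices.\<close>

definition delete_vertex :: "'a dtree \<Rightarrow> 'a \<Rightarrow> 'a set \<Rightarrow> 'a dtree" where
  "delete_vertex T v R = \<lparr>
     verts = verts T - {v},
     parent = (\<lambda>u. if parent T u = Some v then parent T v else parent T u),
     desc = (desc T - {v} - children T v) \<union> R \<rparr>"

text \<open>The trees \<open>(T/v)\<^sub>r\<close>, with the index \<open>r\<close> replaced by the set \<open>R \<subseteq> children T v\<close> of descent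
  vertices it stands for. If \<open>v\<close> is the root and not a leaf, its parent is the bottom vertex of the
  chain above \<open>T\<close>, so one chain vertex, which becomes the root, is included before deleting \<open>v\<close>.
  In all other cases \<open>v\<close> is deleted from (a copy of) \<open>T\<close> itself.\<close>

definition contract :: "'a dtree \<Rightarrow> 'a \<Rightarrow> 'a set \<Rightarrow> ('a + nat) dtree" where
  "contract T v R =
     (let s = card (verts T);
          m = (if is_root T v \<and> \<not> is_leaf T v then s + 1 else s)
      in delete_vertex (G T m) (Inl v) (Inl ` R))"

end

theory Submission
  imports Defs
begin

text \<open>
  A labeling of \<open>G T (n + 1)\<close> with descent set \<open>V\<^sub>D\<close> is classified by the vertex \<open>v\<close> that carries the
  largest label. If \<open>v\<close> has a parent, then \<open>v\<close> itself is a descent, and no child of \<open>v\<close> can be one. So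
  \<open>v\<close> is either the top of the chain or a descent vertex without descent children, and the latter
  vertices are those of \<open>V'\<close> (the leaves among them) and \<open>V''\<close> (the others).

  Deleting \<open>v\<close> together with its label, and attaching the children of \<open>v\<close> to the parent of \<open>v\<close>, gives a
  labeling with one vertex less. The order relation between a vertex and its parent is unchanged
  except at the children of \<open>v\<close>, which have a new parent and may or may not be descents for it.
  Conversely the largest label can always be put back at \<open>v\<close>. Hence the labelings with maximum at \<open>v\<close>
  correspond to the labelings of the contracted tree in which the set \<open>R\<close> of former children of \<open>v\<close> that
  are descents is arbitrary; this is \<open>card_max_at_realizations\<close>, which covers leaves as the case without
  children. For the top of the chain the deletion leaves \<open>G T n\<close>
  (\<open>card_max_at_top\<close>). Summing over \<open>v\<close> gives the recurrence \<open>card_realizations_G_Suc\<close>.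

  It remains to see that contracting commutes with adding the chain
  (\<open>card_realizations_delete_G\<close>). If \<open>v\<close> is a root with children, the lowest chain vertex has to be part
  of the tree before \<open>v\<close> is deleted. In general any number \<open>k\<close> of chain vertices may be counted as
  belonging to the tree without changing the result, so that the root and the other vertices are
  treated together.

  The arguments about maximal labels only look at a vertex, its parent and its children. They are
  therefore carried out for arbitrary finite structures in which no vertex is its own parent; such
  a structure may be a forest, as happens when a root is deleted.
\<close>

section \<open>Labelings with prescribed descent set\<close>

definition well_formed :: "'a dtree \<Rightarrow> bool" where
  "well_formed A \<longleftrightarrow> finite (verts A) \<and> desc A \<subseteq> verts A \<and>
     (\<forall>v \<in> verts A. \<forall>u. parent A v = Some u \<longrightarrow> u \<in> verts A)"

definition loop_free :: "'a dtree \<Rightarrow> bool" where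
  "loop_free A \<longleftrightarrow> (\<forall>v \<in> verts A. parent A v \<noteq> Some v)"

text \<open>For \<open>A = G T n\<close> this is the set \<open>D T n\<close>. Letting \<open>A\<close> be any structure gives meaning to the
  count also after a vertex has been deleted from \<open>G T n\<close>.\<close>

definition realizations :: "'a dtree \<Rightarrow> ('a \<Rightarrow> nat) set" where
  "realizations A = {w \<in> labelings A. Des A w = desc A}"

definition max_at :: "'a dtree \<Rightarrow> 'a \<Rightarrow> ('a \<Rightarrow> nat) set" where
  "max_at A v = {w \<in> labelings A. w v = card (verts A)}"

lemma delete_vertex_simps [simp]:
  "verts (delete_vertex A v R) = verts A - {v}"
  "parent (delete_vertex A v R) = (\<lambda>u. if parent A u = Some v then parent A v else parent A u)"
  "desc (delete_vertex A v R) = (desc A - {v} - children A v) \<union> R"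
  by (simp_all add: delete_vertex_def)

lemma labelings_range:
  assumes "w \<in> labelings A" "u \<in> verts A"
  shows "w u \<in> {1..card (verts A)}"
  using assms by (auto simp: labelings_def bij_betw_def)

lemma labelings_inj:
  assumes "w \<in> labelings A" "u \<in> verts A" "v \<in> verts A" "w u = w v"
  shows "u = v"
  using assms by (auto simp: labelings_def bij_betw_def inj_on_def)

lemma finite_labelings:
  assumes "finite (verts A)"
  shows "finite (labelings A)"
proof (rule finite_subset)
  show "labelings A \<subseteq> verts A \<rightarrow>\<^sub>E {1..card (verts A)}"
  proof
    fix w assume w: "w \<in> labelings A"
    then show "w \<in> verts A \<rightarrow>\<^sub>E {1..card (verts A)}"
      using labelings_range[OF w] by (intro PiE_I) (auto simp: labelings_def extensional_def)
  qed
  show "finite (verts A \<rightarrow>\<^sub>E {1..card (verts A)})"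
    using assms by (intro finite_PiE) auto
qed

lemma finite_realizations: "finite (verts A) \<Longrightarrow> finite (realizations A)"
  using finite_labelings[of A] by (simp add: realizations_def)

section \<open>Deleting the vertex with the largest label\<close>

text \<open>The inverse map puts the largest label back at \<open>v\<close>.\<close>

lemma bij_betw_max_at:
  assumes fin: "finite (verts A)" and v: "v \<in> verts A"
  shows "bij_betw (\<lambda>w. restrict w (verts A - {v})) (max_at A v)
           (labelings (delete_vertex A v R))"
proof (rule bij_betw_byWitness[where f' = "\<lambda>w. w(v := card (verts A))"])
  let ?n = "card (verts A)"
  have n: "?n > 0" using assms by (auto simp: card_gt_0_iff)
  have range_eq: "{1..?n} - {?n} = {1..?n - 1}" using n by auto
  show "\<forall>w \<in> max_at A v. (restrict w (verts A - {v}))(v := ?n) = w"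
    using v by (auto simp: max_at_def labelings_def extensional_def fun_eq_iff)
  show "\<forall>w \<in> labelings (delete_vertex A v R). restrict (w(v := ?n)) (verts A - {v}) = w"
    by (auto simp: labelings_def extensional_def fun_eq_iff)
  show "(\<lambda>w. restrict w (verts A - {v})) ` max_at A v \<subseteq> labelings (delete_vertex A v R)"
  proof
    fix w' assume "w' \<in> (\<lambda>w. restrict w (verts A - {v})) ` max_at A v"
    then obtain w where w': "w' = restrict w (verts A - {v})"
      and bij: "bij_betw w (verts A) {1..?n}" and wv: "w v = ?n"
      by (auto simp: max_at_def labelings_def)
    have "bij_betw w (verts A - {v}) ({1..?n} - {?n})"
      using bij_betw_DiffI[OF bij, of "{v}" "{?n}"] v wv n by (auto simp: bij_betw_def)
    then have "bij_betw w' (verts A - {v}) {1..?n - 1}"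
      unfolding range_eq by (subst bij_betw_cong[of _ _ w]) (auto simp: w')
    then show "w' \<in> labelings (delete_vertex A v R)"
      using fin v by (simp add: labelings_def w')
  qed
  show "(\<lambda>w. w(v := ?n)) ` labelings (delete_vertex A v R) \<subseteq> max_at A v"
  proof
    fix w' assume "w' \<in> (\<lambda>w. w(v := ?n)) ` labelings (delete_vertex A v R)"
    then obtain w where w': "w' = w(v := ?n)" and ext: "w \<in> extensional (verts A - {v})"
      and bij: "bij_betw w (verts A - {v}) {1..?n - 1}"
      using fin v by (auto simp: labelings_def)
    have "bij_betw w' (verts A - {v}) {1..?n - 1}"
      using bij by (subst bij_betw_cong[of _ _ w]) (auto simp: w')
    then have "bij_betw w' ((verts A - {v}) \<union> {v}) ({1..?n - 1} \<union> {?n})"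
      using n by (intro bij_betw_combine) (auto simp: w')
    moreover have "(verts A - {v}) \<union> {v} = verts A" "{1..?n - 1} \<union> {?n} = {1..?n}"
      using v n by auto
    ultimately show "w' \<in> max_at A v"
      using ext v by (auto simp: max_at_def labelings_def w' extensional_def)
  qed
qed

text \<open>A vertex that is neither \<open>v\<close> nor a child of \<open>v\<close> keeps its parent when \<open>v\<close> is deleted, so its
  status is unchanged. Maximality of the label of \<open>v\<close> decides the status of \<open>v\<close> and of its children.\<close>

lemma Des_max_at:
  assumes A: "well_formed A" and loop: "loop_free A" and v: "v \<in> verts A" and w: "w \<in> max_at A v"
  shows "Des A w = (Des (delete_vertex A v R) (restrict w (verts A - {v})) - children A v)
           \<union> (if parent A v = None then {} else {v})"
    (is "_ = ?rhs")
proof -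
  have lab: "w \<in> labelings A" and wv: "w v = card (verts A)"
    using w by (auto simp: max_at_def)
  have par: "x \<in> verts A" "x \<noteq> u" if "u \<in> verts A" "parent A u = Some x" for u x
    using A loop that by (auto simp: well_formed_def loop_free_def)
  have lt: "w u < w v" if "u \<in> verts A" "u \<noteq> v" for u
    using labelings_range[OF lab that(1)] labelings_inj[OF lab that(1) v] that(2) wv
    by fastforce
  have "u \<in> Des A w \<longleftrightarrow> u \<in> ?rhs" for u
  proof (cases "u \<in> verts A")
    case u: True
    consider "u = v" | "u \<noteq> v" "u \<in> children A v" | "u \<noteq> v" "u \<notin> children A v" by blast
    then show ?thesis
    proof cases
      case 1
      then show ?thesis using v par[OF v] lt by (auto simp: Des_def)
    next
      case 2
      then show ?thesis using lt[OF u] by (auto simp: Des_def children_def)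
    next
      case 3
      then show ?thesis using u par[OF u] by (auto simp: Des_def children_def)
    qed
  qed (auto simp: Des_def v)
  then show ?thesis by blast
qed

lemma max_at_realizations_empty:
  assumes A: "well_formed A" and loop: "loop_free A" and v: "v \<in> verts A"
    and bad: "children A v \<inter> desc A \<noteq> {} \<or> (v \<in> desc A \<longleftrightarrow> parent A v = None)"
  shows "realizations A \<inter> max_at A v = {}"
proof -
  have "v \<notin> children A v" using loop by (auto simp: loop_free_def children_def)
  then show ?thesis
    using Des_max_at[OF A loop v] bad by (fastforce simp: realizations_def Des_def split: if_splits)
qed

text \<open>Once \<open>v\<close> and its children have the status that the maximum forces on them, the only
  remaining condition on the smaller labeling concerns the vertices that are not children of \<open>v\<close>.
  Splitting by the set \<open>R\<close> of descents among the children turns this partial condition into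
  realizations of full descent sets.\<close>

lemma card_max_at_realizations:
  assumes A: "well_formed A" and loop: "loop_free A" and v: "v \<in> verts A"
    and ch: "children A v \<inter> desc A = {}" and desc: "v \<in> desc A \<longleftrightarrow> parent A v \<noteq> None"
  shows "card (realizations A \<inter> max_at A v)
    = (\<Sum>R \<in> Pow (children A v). card (realizations (delete_vertex A v R)))"
proof -
  let ?B = "delete_vertex A v" and ?C = "children A v"
  let ?r = "\<lambda>w. restrict w (verts A - {v})"
  have fin: "finite (verts A)" using A by (simp add: well_formed_def)
  have vB: "v \<notin> Des (?B {}) w" for w by (simp add: Des_def)
  have bij: "bij_betw ?r (max_at A v) (labelings (?B {}))"
    by (rule bij_betw_max_at[OF fin v])
  have real: "realizations (?B R)
      = {w \<in> labelings (?B {}). Des (?B {}) w = (desc A - {v} - ?C) \<union> R}" for R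
    by (simp add: realizations_def labelings_def Des_def)
  have iff: "w \<in> realizations A \<longleftrightarrow> Des (?B {}) (?r w) - ?C = desc A - {v}"
    if w: "w \<in> max_at A v" for w
  proof -
    have "w \<in> labelings A" using w by (simp add: max_at_def)
    then show ?thesis
      using Des_max_at[OF A loop v w, of "{}"] desc vB[of "?r w"]
      by (auto simp: realizations_def)
  qed
  have "?r ` (realizations A \<inter> max_at A v)
      = {w \<in> labelings (?B {}). Des (?B {}) w - ?C = desc A - {v}}"
  proof -
    have "?r ` (realizations A \<inter> max_at A v) = {w \<in> ?r ` max_at A v. P w}"
      if "\<And>w. w \<in> max_at A v \<Longrightarrow> w \<in> realizations A \<longleftrightarrow> P (?r w)" for P
      using that by blast
    from this[OF iff] show ?thesis by (simp only: bij_betw_imp_surj_on[OF bij])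
  qed
  also have "\<dots> = (\<Union>R \<in> Pow ?C. realizations (?B R))"
  proof -
    have "Des (?B {}) w - ?C = desc A - {v} \<longleftrightarrow>
        (\<exists>R \<in> Pow ?C. Des (?B {}) w = (desc A - {v} - ?C) \<union> R)" for w
    proof
      assume "Des (?B {}) w - ?C = desc A - {v}"
      then show "\<exists>R \<in> Pow ?C. Des (?B {}) w = (desc A - {v} - ?C) \<union> R"
        using ch by (intro bexI[of _ "Des (?B {}) w \<inter> ?C"]) auto
    qed (use ch in auto)
    then show ?thesis
      unfolding real by (intro set_eqI) (simp only: mem_Collect_eq UN_iff, simp only: Bex_def, metis)
  qed
  finally have image: "?r ` (realizations A \<inter> max_at A v)
      = (\<Union>R \<in> Pow ?C. realizations (?B R))" .
  have "card (realizations A \<inter> max_at A v) = card (?r ` (realizations A \<inter> max_at A v))"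
    using bij by (intro card_image[symmetric]) (auto simp: bij_betw_def inj_on_def)
  also have "\<dots> = (\<Sum>R \<in> Pow ?C. card (realizations (?B R)))"
    unfolding image
  proof (rule card_UN_disjoint)
    show "finite (Pow ?C)" using fin by (simp add: children_def)
    show "\<forall>R \<in> Pow ?C. finite (realizations (?B R))"
      using fin by (intro ballI finite_realizations) simp
    show "\<forall>R \<in> Pow ?C. \<forall>S \<in> Pow ?C. R \<noteq> S \<longrightarrow>
        realizations (?B R) \<inter> realizations (?B S) = {}"
    proof (intro ballI impI)
      fix R S assume RS: "R \<in> Pow ?C" "S \<in> Pow ?C" "R \<noteq> S"
      have "(desc A - {v} - ?C) \<union> R \<noteq> (desc A - {v} - ?C) \<union> S"
        using RS by blast
      then show "realizations (?B R) \<inter> realizations (?B S) = {}"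
        unfolding real by (simp only: disjoint_iff mem_Collect_eq) metis
    qed
  qed
  finally show ?thesis .
qed

section \<open>Classification by the position of the largest label\<close>

lemma card_realizations_by_max:
  assumes fin: "finite (verts A)" and ne: "verts A \<noteq> {}"
  shows "card (realizations A) = (\<Sum>v \<in> verts A. card (realizations A \<inter> max_at A v))"
proof -
  have "\<exists>v \<in> verts A. w v = card (verts A)" if "w \<in> labelings A" for w
  proof -
    have "card (verts A) \<in> {1..card (verts A)}"
      using assms by (simp add: Suc_le_eq card_gt_0_iff)
    then have "card (verts A) \<in> w ` verts A"
      using that by (simp add: labelings_def bij_betw_def)
    then show ?thesis by auto
  qed
  then have "realizations A = (\<Union>v \<in> verts A. realizations A \<inter> max_at A v)"
    by (auto simp: realizations_def max_at_def)
  also have "card \<dots> = (\<Sum>v \<in> verts A. card (realizations A \<inter> max_at A v))"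
  proof (rule card_UN_disjoint[OF fin])
    show "\<forall>v \<in> verts A. finite (realizations A \<inter> max_at A v)"
      using finite_realizations[OF fin] by simp
    show "\<forall>u \<in> verts A. \<forall>v \<in> verts A. u \<noteq> v \<longrightarrow>
        (realizations A \<inter> max_at A u) \<inter> (realizations A \<inter> max_at A v) = {}"
      by (auto simp: max_at_def dest: labelings_inj)
  qed
  finally show ?thesis .
qed

section \<open>Invariance under isomorphism\<close>

lemma restrict_comp_realizations:
  assumes f: "bij_betw f (verts A) (verts B)"
    and par: "\<And>x. x \<in> verts A \<Longrightarrow> parent B (f x) = map_option f (parent A x)"
    and A: "well_formed A" and desc: "desc B = f ` desc A"
    and w: "w \<in> realizations B"
  shows "restrict (w \<circ> f) (verts A) \<in> realizations A"
proof -
  let ?w = "restrict (w \<circ> f) (verts A)"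
  have inj: "inj_on f (verts A)" and img: "verts B = f ` verts A"
    using f by (auto simp: bij_betw_def)
  have "bij_betw (w \<circ> f) (verts A) {1..card (verts B)}"
    using w f by (intro bij_betw_trans[OF f]) (simp add: realizations_def labelings_def)
  then have "bij_betw ?w (verts A) {1..card (verts A)}"
    using bij_betw_same_card[OF f] by (subst bij_betw_cong[of _ _ "w \<circ> f"]) auto
  then have lab: "?w \<in> labelings A" by (simp add: labelings_def)
  have closed: "u \<in> verts A" if "x \<in> verts A" "parent A x = Some u" for x u
    using A that by (auto simp: well_formed_def)
  have "x \<in> Des A ?w \<longleftrightarrow> f x \<in> Des B w" if x: "x \<in> verts A" for x
    using x closed[OF x] par[OF x] by (auto simp: Des_def img)
  moreover have "Des B w = f ` desc A" using w desc by (simp add: realizations_def)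
  moreover have "f x \<in> f ` desc A \<longleftrightarrow> x \<in> desc A" if "x \<in> verts A" for x
    using A that inj by (auto simp: well_formed_def inj_on_def)
  moreover have "Des A ?w \<subseteq> verts A" "desc A \<subseteq> verts A"
    using A by (auto simp: Des_def well_formed_def)
  ultimately have "Des A ?w = desc A" by blast
  then show ?thesis using lab by (simp add: realizations_def)
qed

lemma card_realizations_iso:
  assumes f: "bij_betw f (verts A) (verts B)"
    and par: "\<And>x. x \<in> verts A \<Longrightarrow> parent B (f x) = map_option f (parent A x)"
    and A: "well_formed A" and B: "well_formed B" and desc: "desc B = f ` desc A"
  shows "card (realizations A) = card (realizations B)"
proof -
  let ?g = "inv_into (verts A) f"
  have inj: "inj_on f (verts A)" and img: "verts B = f ` verts A"
    using f by (auto simp: bij_betw_def)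
  have gf: "?g (f x) = x" if "x \<in> verts A" for x using inj that by simp
  have g: "bij_betw ?g (verts B) (verts A)" using f by (rule bij_betw_inv_into)
  have gpar: "parent A (?g y) = map_option ?g (parent B y)" if "y \<in> verts B" for y
  proof -
    obtain x where x: "x \<in> verts A" "y = f x" using \<open>y \<in> verts B\<close> unfolding img by blast
    then show ?thesis
      using par[OF x(1)] gf A by (cases "parent A x") (auto simp: well_formed_def)
  qed
  have "?g ` f ` desc A = desc A"
    using A gf by (intro inv_into_image_cancel[OF inj]) (simp add: well_formed_def)
  then have gdesc: "desc A = ?g ` desc B" using desc by simp
  have "bij_betw (\<lambda>w. restrict (w \<circ> f) (verts A)) (realizations B) (realizations A)"
  proof (rule bij_betw_byWitness[where f' = "\<lambda>w. restrict (w \<circ> ?g) (verts B)"])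
    have "?g y \<in> verts A" "f (?g y) = y" if "y \<in> verts B" for y
      using that img by (auto intro: inv_into_into f_inv_into_f)
    then show "\<forall>w \<in> realizations B.
        restrict (restrict (w \<circ> f) (verts A) \<circ> ?g) (verts B) = w"
      by (auto simp: realizations_def labelings_def extensional_def fun_eq_iff)
    show "\<forall>w \<in> realizations A.
        restrict (restrict (w \<circ> ?g) (verts B) \<circ> f) (verts A) = w"
      using gf img by (auto simp: realizations_def labelings_def extensional_def fun_eq_iff)
    show "(\<lambda>w. restrict (w \<circ> f) (verts A)) ` realizations B \<subseteq> realizations A"
      using restrict_comp_realizations[OF f par A desc] by blast
    show "(\<lambda>w. restrict (w \<circ> ?g) (verts B)) ` realizations A \<subseteq> realizations B"
      using restrict_comp_realizations[OF g gpar B gdesc] by blast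
  qed
  from bij_betw_same_card[OF this] show ?thesis by simp
qed

section \<open>The recurrence for trees with a chain on top\<close>

lemma verts_G: "verts (G T n) = Inl ` verts T \<union> Inr ` {..<n - card (verts T)}"
  and desc_G: "desc (G T n) = Inl ` desc T"
  and parent_G_Inl: "parent (G T n) (Inl v) = (case parent T v of
         Some u \<Rightarrow> Some (Inl u)
       | None \<Rightarrow> if 0 < n - card (verts T) then Some (Inr 0) else None)"
  and parent_G_Inr: "parent (G T n) (Inr i) =
         (if Suc i < n - card (verts T) then Some (Inr (Suc i)) else None)"
  by (simp_all add: G_def)

lemmas G_simps = verts_G desc_G parent_G_Inl parent_G_Inr

lemma D_eq_realizations: "D T n = realizations (G T n)"
  by (simp add: D_def realizations_def desc_G)

lemma children_G: "children (G T n) (Inl v) = Inl ` children T v"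
  by (auto simp: children_def G_simps split: option.splits if_splits)

lemma card_verts_G:
  fixes T :: "'a dtree"
  assumes "finite (verts T)" "card (verts T) \<le> n"
  shows "card (verts (G T n)) = n"
proof -
  have "card (verts (G T n))
      = card (Inl ` verts T :: ('a + nat) set) + card (Inr ` {..<n - card (verts T)} :: ('a + nat) set)"
    unfolding verts_G using assms by (intro card_Un_disjoint) auto
  then show ?thesis using assms by (simp add: card_image)
qed

lemma well_formed_G: "well_formed T \<Longrightarrow> well_formed (G T n)"
  by (auto simp: well_formed_def G_simps split: option.splits if_splits)

lemma well_formed_delete_vertex:
  assumes "well_formed A" "loop_free A" "R \<subseteq> children A v" "v \<in> verts A"
  shows "well_formed (delete_vertex A v R)"
proof -
  have "v \<notin> children A v" using assms(2) by (auto simp: loop_free_def children_def)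
  moreover have "x \<in> verts A \<and> x \<noteq> v" if "parent A v = Some x" for x
    using assms that by (auto simp: well_formed_def loop_free_def)
  ultimately show ?thesis
    using assms by (auto simp: well_formed_def children_def)
qed

lemma loop_free_G: "loop_free T \<Longrightarrow> loop_free (G T n)"
  by (auto simp: loop_free_def G_simps split: option.splits if_splits)

text \<open>Deleting the top of the chain makes its children parentless. A parentless vertex is never a
  descent, so only \<open>R = {}\<close> contributes. When \<open>n\<close> is the size of \<open>T\<close>, the children in question are the
  roots of \<open>T\<close>; if one of them is a descent vertex, both sides vanish.\<close>

lemma card_max_at_top:
  assumes T: "well_formed T" "loop_free T" and n: "card (verts T) \<le> n"
  shows "card (realizations (G T (Suc n)) \<inter> max_at (G T (Suc n)) (Inr (n - card (verts T))))
    = card (realizations (G T n))"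
proof -
  let ?A = "G T (Suc n)" and ?t = "Inr (n - card (verts T)) :: 'a + nat"
  let ?C = "children ?A ?t"
  have A: "well_formed ?A" "loop_free ?A" using T by (simp_all add: well_formed_G loop_free_G)
  have t: "?t \<in> verts ?A" "parent ?A ?t = None" using n by (auto simp: G_simps)
  have verts: "verts (delete_vertex ?A ?t R) = verts (G T n)" for R
    using n by (auto simp: G_simps)
  have Gn: "parent (delete_vertex ?A ?t R) u = parent (G T n) u" if "u \<in> verts (G T n)" for R u
    using that n by (auto simp: G_simps Suc_diff_le split: option.splits)
  have C_root: "parent (G T n) u = None" if "u \<in> ?C" for u
    using that n by (auto simp: children_def G_simps Suc_diff_le split: option.splits if_splits)
  have Des: "Des (delete_vertex ?A ?t R) w = Des (G T n) w" for R w
    unfolding Des_def verts by (intro Collect_cong conj_cong refl) (simp only: Gn)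
  have lab: "labelings (delete_vertex ?A ?t R) = labelings (G T n)" for R
    unfolding labelings_def verts ..
  have Des_C: "Des (G T n) w \<inter> ?C = {}" for w using C_root by (auto simp: Des_def)
  show ?thesis
  proof (cases "?C \<inter> desc ?A = {}")
    case False
    have "realizations (G T n) = {}"
      using False Des_C by (fastforce simp: realizations_def desc_G)
    then show ?thesis
      using max_at_realizations_empty[OF A t(1)] False by simp
  next
    case True
    have "card (realizations ?A \<inter> max_at ?A ?t)
        = (\<Sum>R \<in> Pow ?C. card (realizations (delete_vertex ?A ?t R)))"
      using True t A by (intro card_max_at_realizations) (auto simp: desc_G)
    also have "\<dots> = (\<Sum>R \<in> Pow ?C. if R = {} then card (realizations (G T n)) else 0)"
    proof (rule sum.cong[OF refl])
      fix R assume R: "R \<in> Pow ?C"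
      have "desc (delete_vertex ?A ?t R) = desc (G T n) \<union> R"
        using True by (auto simp: desc_G)
      then have eq: "realizations (delete_vertex ?A ?t R)
          = {w \<in> labelings (G T n). Des (G T n) w = desc (G T n) \<union> R}"
        by (simp only: realizations_def Des lab)
      show "card (realizations (delete_vertex ?A ?t R))
          = (if R = {} then card (realizations (G T n)) else 0)"
      proof (cases "R = {}")
        case False
        then have "realizations (delete_vertex ?A ?t R) = {}"
          unfolding eq using R Des_C by blast
        then show ?thesis using False by simp
      next
        case empty: True
        have "realizations (delete_vertex ?A ?t R) = realizations (G T n)"
          unfolding eq unfolding empty by (simp add: realizations_def)
        then show ?thesis by (simp add: empty)
      qed
    qed
    also have "\<dots> = card (realizations (G T n))"
      using A by (simp add: children_def well_formed_def)
    finally show ?thesis .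
  qed
qed

lemma card_realizations_G_Suc:
  assumes T: "well_formed T" "loop_free T" and n: "card (verts T) \<le> n"
  shows "card (realizations (G T (Suc n))) = card (realizations (G T n))
    + (\<Sum>v \<in> {v \<in> desc T. children T v \<inter> desc T = {}}. \<Sum>R \<in> Pow (children T v).
        card (realizations (delete_vertex (G T (Suc n)) (Inl v) (Inl ` R))))"
proof -
  let ?A = "G T (Suc n)" and ?k = "n - card (verts T)"
  let ?t = "Inr ?k :: 'a + nat" and ?P = "{v \<in> desc T. children T v \<inter> desc T = {}}"
  let ?f = "\<lambda>v. card (realizations ?A \<inter> max_at ?A v)"
  have A: "well_formed ?A" "loop_free ?A" using T by (simp_all add: well_formed_G loop_free_G)
  have fin: "finite (verts T)" and desc: "desc T \<subseteq> verts T"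
    using T by (simp_all add: well_formed_def)
  have k: "Suc n - card (verts T) = Suc ?k" using n by simp
  \<comment> \<open>a chain vertex below the top has a parent but is an ascent vertex; a vertex of \<open>T\<close> always has
    a parent, since the chain is nonempty, so it must be a descent without descent children\<close>
  have vanish: "?f x = 0" if "x \<in> verts ?A - insert ?t (Inl ` ?P)" for x
  proof -
    have "children ?A x \<inter> desc ?A \<noteq> {} \<or> (x \<in> desc ?A \<longleftrightarrow> parent ?A x = None)"
    proof (cases x)
      case (Inl v)
      then have v: "v \<in> verts T" "v \<notin> ?P" using that by (auto simp: G_simps)
      have "parent ?A x \<noteq> None" by (simp add: Inl parent_G_Inl k split: option.splits)
      moreover have "children ?A x \<inter> desc ?A = Inl ` (children T v \<inter> desc T)"
        by (auto simp: Inl children_G desc_G)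
      ultimately show ?thesis using v by (auto simp: Inl desc_G)
    next
      case (Inr i)
      then show ?thesis using that by (auto simp: G_simps k)
    qed
    then show ?thesis using max_at_realizations_empty[OF A, of x] that by simp
  qed
  have "card (realizations ?A) = sum ?f (verts ?A)"
    using A k by (intro card_realizations_by_max) (auto simp: well_formed_def verts_G)
  also have "\<dots> = sum ?f (insert ?t (Inl ` ?P))"
    using vanish A desc k
    by (intro sum.mono_neutral_right) (auto simp: well_formed_def verts_G)
  also have "\<dots> = ?f ?t + sum ?f (Inl ` ?P)"
    using finite_subset[OF desc fin] by (intro sum.insert) auto
  also have "?f ?t = card (realizations (G T n))" by (rule card_max_at_top[OF T n])
  also have "sum ?f (Inl ` ?P) = (\<Sum>v \<in> ?P. ?f (Inl v))" by (simp add: sum.reindex)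
  also have "\<dots> = (\<Sum>v \<in> ?P. \<Sum>R \<in> Pow (children T v).
        card (realizations (delete_vertex ?A (Inl v) (Inl ` R))))"
  proof (rule sum.cong[OF refl])
    fix v assume v: "v \<in> ?P"
    have "?f (Inl v) = (\<Sum>R \<in> Pow (children ?A (Inl v)).
        card (realizations (delete_vertex ?A (Inl v) R)))"
    proof (rule card_max_at_realizations[OF A])
      show "Inl v \<in> verts ?A" using v desc by (auto simp: verts_G)
      show "children ?A (Inl v) \<inter> desc ?A = {}" using v by (auto simp: children_G desc_G)
      show "Inl v \<in> desc ?A \<longleftrightarrow> parent ?A (Inl v) \<noteq> None"
        using v by (auto simp: desc_G parent_G_Inl k split: option.splits)
    qed
    also have "Pow (children ?A (Inl v)) = image Inl ` Pow (children T v)"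
      by (simp add: children_G image_Pow_surj)
    also have "(\<Sum>R \<in> image Inl ` Pow (children T v).
          card (realizations (delete_vertex ?A (Inl v) R)))
        = (\<Sum>R \<in> Pow (children T v).
          card (realizations (delete_vertex ?A (Inl v) (Inl ` R))))"
      by (subst sum.reindex) (auto intro!: inj_onI simp: inj_image_eq_iff)
    finally show "?f (Inl v) = (\<Sum>R \<in> Pow (children T v).
        card (realizations (delete_vertex ?A (Inl v) (Inl ` R))))" .
  qed
  finally show ?thesis .
qed

text \<open>For an empty \<open>T\<close> the recurrence has only its first summand. The result shows that the
  convention \<open>d \<emptyset> k = 1\<close> agrees with counting the labelings of a bare chain of length \<open>k\<close>,
  which is what remains when the only vertex of a one-vertex tree is deleted.\<close>

lemma card_realizations_chain:
  assumes "verts T = {}" "desc T = {}"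
  shows "card (realizations (G T n)) = 1"
proof (induction n)
  case 0
  have "realizations (G T 0) = {\<lambda>_. undefined}"
    using assms by (auto simp: realizations_def labelings_def Des_def G_simps bij_betw_def)
  then show ?case by simp
next
  case (Suc n)
  have "well_formed T" "loop_free T" using assms by (simp_all add: well_formed_def loop_free_def)
  from card_realizations_G_Suc[OF this, of n] show ?case using assms Suc.IH by simp
qed

lemma d_eq_card_realizations:
  assumes "verts T = {} \<Longrightarrow> desc T = {}"
  shows "d T n = card (realizations (G T n))"
  using assms card_realizations_chain[of T n] by (auto simp: d_def D_eq_realizations)

section \<open>Contraction commutes with adding the chain\<close>

text \<open>On the left, the \<open>k\<close> lowest chain vertices belong to the tree before \<open>v\<close> is deleted and the
  remaining ones are added afterwards; on the right the whole chain is present from the start. The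
  two structures differ only in the names of the chain vertices: the first vertex of the outer
  chain is the vertex with index \<open>k\<close> of the whole chain.\<close>

lemma card_realizations_delete_G:
  assumes T: "well_formed T" "loop_free T" and v: "v \<in> verts T" and R: "R \<subseteq> children T v"
    and k: "card (verts T) + k \<le> Suc n"
  shows "card (realizations (G (delete_vertex (G T (card (verts T) + k)) (Inl v) (Inl ` R)) n))
    = card (realizations (delete_vertex (G T (Suc n)) (Inl v) (Inl ` R)))"
proof -
  let ?s = "card (verts T)"
  let ?H = "delete_vertex (G T (?s + k)) (Inl v) (Inl ` R)"
  let ?B = "delete_vertex (G T (Suc n)) (Inl v) (Inl ` R)"
  define f :: "('a + nat) + nat \<Rightarrow> 'a + nat"
    where "f = case_sum id (\<lambda>i. Inr (i + k))"
  have f: "f (Inl x) = x" "f (Inr i) = Inr (i + k)" for x i by (simp_all add: f_def)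
  have wf: "well_formed (delete_vertex (G T m) (Inl v) (Inl ` R))" for m
    using T v R
    by (intro well_formed_delete_vertex well_formed_G loop_free_G)
      (auto simp: children_G verts_G)
  have s: "?s > 0" using T v by (auto simp: well_formed_def card_gt_0_iff)
  have "card (verts (G T (?s + k))) = ?s + k"
    using T by (intro card_verts_G) (auto simp: well_formed_def)
  then have cardH: "card (verts ?H) = ?s + k - 1"
    using v T by (simp add: verts_G well_formed_def)
  have chain: "n - card (verts ?H) = Suc n - ?s - k" using k s cardH by simp
  have vertsH: "verts ?H = Inl ` (verts T - {v}) \<union> Inr ` {..<k}" by (auto simp: verts_G)
  have vertsB: "verts ?B = Inl ` (verts T - {v}) \<union> Inr ` {..<Suc n - ?s}"
    by (auto simp: verts_G)
  have vertsG: "verts (G ?H n) = Inl ` verts ?H \<union> Inr ` {..<Suc n - ?s - k}"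
    by (simp only: verts_G[of ?H] chain)
  show ?thesis
  proof (rule card_realizations_iso)
    show "bij_betw f (verts (G ?H n)) (verts ?B)"
    proof (rule bij_betwI')
      show "\<And>x y. x \<in> verts (G ?H n) \<Longrightarrow> y \<in> verts (G ?H n) \<Longrightarrow> (f x = f y) = (x = y)"
        unfolding vertsG vertsH by (auto simp: f)
      show "\<And>x. x \<in> verts (G ?H n) \<Longrightarrow> f x \<in> verts ?B"
        unfolding vertsG vertsH vertsB using k by (auto simp: f)
      fix y assume y: "y \<in> verts ?B"
      show "\<exists>x \<in> verts (G ?H n). y = f x"
      proof (cases "y \<in> verts ?H")
        case True
        then show ?thesis unfolding vertsG by (intro bexI[of _ "Inl y"]) (auto simp: f)
      next
        case False
        then obtain i where "y = Inr i" "k \<le> i" "i < Suc n - ?s"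
          using y unfolding vertsH vertsB by force
        then show ?thesis
          unfolding vertsG by (intro bexI[of _ "Inr (i - k)"]) (auto simp: f)
      qed
    qed
    show "desc ?B = f ` desc (G ?H n)"
      by (simp add: desc_G image_image f children_G)
    show "parent ?B (f x) = map_option f (parent (G ?H n) x)" if "x \<in> verts (G ?H n)" for x
    proof (cases x)
      case (Inr i)
      then show ?thesis using that unfolding vertsG
        by (auto simp: f parent_G_Inr chain simp del: delete_vertex_simps(1))
    next
      case (Inl y)
      then have y: "y \<in> verts ?H" using that unfolding vertsG by auto
      have "parent ?B y = map_option f (case parent ?H y of Some u \<Rightarrow> Some (Inl u)
          | None \<Rightarrow> if 0 < Suc n - ?s - k then Some (Inr 0) else None)"
      proof (cases y)
        case (Inl z)
        then show ?thesis
          using k by (cases "parent T z"; cases "parent T v"; cases k) (simp_all add: f parent_G_Inl)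
      next
        case (Inr j)
        then have "j < k" using y unfolding vertsH by auto
        then show ?thesis
          using k by (cases "Suc j = k") (simp_all add: Inr f parent_G_Inr, auto)
      qed
      then show ?thesis unfolding Inl f parent_G_Inl[of ?H] chain .
    qed
    show "well_formed (G ?H n)" "well_formed ?B" by (simp_all only: wf well_formed_G)
  qed
qed

lemma rooted_tree_well_formed: "rooted_tree T \<Longrightarrow> well_formed T"
  by (simp add: rooted_tree_def well_formed_def)

text \<open>From a vertex that is its own parent nothing else can be reached, whereas every vertex of a
  rooted tree reaches the root, which has no parent.\<close>

lemma rooted_tree_loop_free:
  assumes "rooted_tree T"
  shows "loop_free T"
  unfolding loop_free_def
proof (intro ballI notI)
  fix v assume v: "v \<in> verts T" and loop: "parent T v = Some v"
  let ?E = "{(x, y). x \<in> verts T \<and> parent T x = Some y}"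
  obtain r where r: "parent T r = None" "(v, r) \<in> ?E\<^sup>*"
    using assms v by (auto simp: rooted_tree_def is_root_def)
  have "x = v" if "(v, x) \<in> ?E\<^sup>*" for x
    using that by induction (auto simp: loop)
  then show False using r loop by fastforce
qed

section \<open>The recurrence for descent counts\<close>

lemma d_contract:
  assumes T: "well_formed T" "loop_free T" and v: "v \<in> verts T" and R: "R \<subseteq> children T v"
    and n: "card (verts T) \<le> n"
  shows "d (contract T v R) n
    = card (realizations (delete_vertex (G T (Suc n)) (Inl v) (Inl ` R)))"
proof -
  \<comment> \<open>the number of chain vertices that are included in the tree before the contraction\<close>
  define k :: nat where "k = (if is_root T v \<and> \<not> is_leaf T v then 1 else 0)"
  have contract: "contract T v R = delete_vertex (G T (card (verts T) + k)) (Inl v) (Inl ` R)"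
    by (simp add: contract_def k_def Let_def)
  have "well_formed (contract T v R)"
    unfolding contract using T v R
    by (intro well_formed_delete_vertex well_formed_G loop_free_G)
      (auto simp: children_G verts_G)
  then have "d (contract T v R) n = card (realizations (G (contract T v R) n))"
    by (intro d_eq_card_realizations) (auto simp: well_formed_def)
  then show ?thesis
    using card_realizations_delete_G[OF T v R, of k n] n by (simp add: contract k_def)
qed

theorem theorem2p5:
  fixes T :: "'a dtree" and s n :: nat
  assumes "rooted_tree T"
    and "card (verts T) = s"
    and "n \<ge> s"
  shows "d T (n + 1) =
           d T n
         + (\<Sum>v \<in> V' T. d (contract T v {}) n)
         + (\<Sum>v \<in> V'' T. \<Sum>R \<in> Pow (children T v). d (contract T v R) n)"
proof -
  have T: "well_formed T" "loop_free T"
    using assms(1) by (simp_all add: rooted_tree_well_formed rooted_tree_loop_free)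
  have n: "card (verts T) \<le> n" using assms by simp
  have desc: "desc T \<subseteq> verts T" "finite (desc T)"
    using T by (auto simp: well_formed_def intro: finite_subset)
  let ?g = "\<lambda>v. \<Sum>R \<in> Pow (children T v). d (contract T v R) n"
  have d: "d T m = card (realizations (G T m))" for m
    using desc by (intro d_eq_card_realizations) auto
  have "d T (n + 1) = d T n + sum ?g {v \<in> desc T. children T v \<inter> desc T = {}}"
  proof -
    have eq: "?g v = (\<Sum>R \<in> Pow (children T v).
        card (realizations (delete_vertex (G T (Suc n)) (Inl v) (Inl ` R))))"
      if "v \<in> desc T" for v
      using that desc by (intro sum.cong refl d_contract[OF T _ _ n]) auto
    have "sum ?g {v \<in> desc T. children T v \<inter> desc T = {}}
        = (\<Sum>v \<in> {v \<in> desc T. children T v \<inter> desc T = {}}. \<Sum>R \<in> Pow (children T v).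
            card (realizations (delete_vertex (G T (Suc n)) (Inl v) (Inl ` R))))"
      by (rule sum.cong[OF refl], rule eq) simp
    then show ?thesis using card_realizations_G_Suc[OF T n] by (simp only: d Suc_eq_plus1)
  qed
  also have "{v \<in> desc T. children T v \<inter> desc T = {}} = V' T \<union> V'' T"
    using desc by (auto simp: V'_def V''_def is_leaf_def)
  also have "sum ?g (V' T \<union> V'' T) = sum ?g (V' T) + sum ?g (V'' T)"
    using desc by (intro sum.union_disjoint) (auto simp: V'_def V''_def)
  also have "sum ?g (V' T) = (\<Sum>v \<in> V' T. d (contract T v {}) n)"
    by (rule sum.cong) (auto simp: V'_def is_leaf_def)
  finally show ?thesis by simp
qed

end
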